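(* Let $(\mathfrak X,\|\cdot\|)$ be a real separable Banach space that admits a normalized Schauder basis $(e_k)_{k\in\mathbb N}$ with projections $\Pi_N$, $N\in\mathbb N$. Let $\sigma:\mathfrak X\to\mathfrak X$ be continuous and bounded. Let $\mu$ be a Borel probability measure (not necessarily Radon) on $\mathfrak X$ and let $1\le p<\infty$. Let $f\in L^p(\mu)$ and $\varepsilon>0$. Assume there exists $\mathcal N^\varepsilon\in\mathfrak N(\sigma)\subset L^p(\mu)$, $$\mathcal N^\varepsilon(x)=\sum_{j=1}^M\langle\ell_j,\sigma(A_jx+b_j)\rangle,\quad x\in\mathfrak X,$$ with suitable $M\in\mathbb N$, $\ell_j\in\mathfrak X'$, $A_j\in\mathcal L(\mathfrak X)$ and $b_j\in\mathfrak X$, such that $\|f-\mathcal N^\varepsilon\|_{L^p(\mu)}<\varepsilon$. Fix $\delta>0$. Then there exists $N_\ast=N_\ast(\mathcal N^\varepsilon,\delta)\in\mathbb N$ such that for all $N\ge N_\ast$ $$\left\|f-\sum_{j=1}^M\langle\ell_j\circ\Pi_N,\sigma(\Pi_NA_j\Pi_N\,\cdot+\Pi_Nb_j)\rangle\right\|_{L^p(\mu)}<\varepsilon+\delta .$$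
   Context: A normalized Schauder basis $(e_k)_{k\in\mathbb N}$ of $\mathfrak X$ satisfies $\|e_k\|=1$ for all $k$, and each $x\in\mathfrak X$ has a unique (norm-convergent) representation $x=\sum_{k=1}^\infty x_ke_k$, $x_k\in\mathbb R$. The projections are $\Pi_N:\mathfrak X\to\operatorname{span}\{e_1,\dots,e_N\}$, $\Pi_Nx=\sum_{k=1}^Nx_ke_k$. $\mathfrak X'$ is the topological dual with pairing $\langle\cdot,\cdot\rangle$, and $\mathcal L(\mathfrak X)$ the continuous linear operators on $\mathfrak X$. Bounded for $\sigma$ means $\sup_{x\in\mathfrak X}\|\sigma(x)\|<\infty$. $\mathfrak N(\sigma)$ is the linear span of the functions $x\mapsto\langle\ell,\sigma(Ax+b)\rangle$, $\ell\in\mathfrak X'$, $A\in\mathcal L(\mathfrak X)$, $b\in\mathfrak X$. $L^p(\mu)$ is the space of (classes of) real-valued $p$-integrable Borel functions on $\mathfrak X$. *)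

theory Defs
  imports "HOL-Analysis.Analysis" "HOL-Probability.Probability_Measure"
begin

text \<open>Basis vectors are indexed from 0, so the N-th projection keeps the indices k < N.\<close>

definition normalized_schauder_basis :: "(nat \<Rightarrow> 'a::real_normed_vector) \<Rightarrow> bool" where
  "normalized_schauder_basis e \<longleftrightarrow>
     (\<forall>k. norm (e k) = 1) \<and> (\<forall>x. \<exists>!c. (\<lambda>k. c k *\<^sub>R e k) sums x)"

definition schauder_coeff :: "(nat \<Rightarrow> 'a::real_normed_vector) \<Rightarrow> 'a \<Rightarrow> nat \<Rightarrow> real" where
  "schauder_coeff e x = (THE c. (\<lambda>k. c k *\<^sub>R e k) sums x)"

definition schauder_proj :: "(nat \<Rightarrow> 'a::real_normed_vector) \<Rightarrow> nat \<Rightarrow> 'a \<Rightarrow> 'a" where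
  "schauder_proj e N x = (\<Sum>k<N. schauder_coeff e x k *\<^sub>R e k)"

definition neurons :: "('a::real_normed_vector \<Rightarrow> 'a) \<Rightarrow> ('a \<Rightarrow> real) set" where
  "neurons \<sigma> = {(\<lambda>x. blinfun_apply l (\<sigma> (blinfun_apply A x + b))) |
     (l :: 'a \<Rightarrow>\<^sub>L real) (A :: 'a \<Rightarrow>\<^sub>L 'a) (b :: 'a). True}"

text \<open>The linear span is written out as the set of finite linear combinations, because
  \<open>'a \<Rightarrow> real\<close> is not an instance of \<open>real_vector\<close>.\<close>

definition neural_span :: "('a::real_normed_vector \<Rightarrow> 'a) \<Rightarrow> ('a \<Rightarrow> real) set" where
  "neural_span \<sigma> = {(\<lambda>x. \<Sum>i<m. c i * g i x) |
     (m :: nat) (c :: nat \<Rightarrow> real) (g :: nat \<Rightarrow> 'a \<Rightarrow> real). \<forall>i<m. g i \<in> neurons \<sigma>}"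

text \<open>Elements are functions rather than classes modulo null sets. Since the Bochner integral of
  a non-integrable function is 0, \<open>Lp_norm\<close> is meaningful only on \<open>Lp_space\<close>.\<close>

definition Lp_space :: "real \<Rightarrow> 'a measure \<Rightarrow> ('a \<Rightarrow> real) set" where
  "Lp_space p M = {f \<in> borel_measurable M. integrable M (\<lambda>x. \<bar>f x\<bar> powr p)}"

definition Lp_norm :: "real \<Rightarrow> 'a measure \<Rightarrow> ('a \<Rightarrow> real) \<Rightarrow> real" where
  "Lp_norm p M f = (\<integral>x. \<bar>f x\<bar> powr p \<partial>M) powr (1 / p)"

end

theory Submission imports Defs begin

text \<open>The projections of a Schauder basis are uniformly bounded, hence \<open>\<Pi>\<^sub>N y\<^sub>N\<close> tends to \<open>y\<close>
  whenever \<open>y\<^sub>N\<close> does, and the projected networks converge pointwise to the given one. They are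
  bounded uniformly in \<open>N\<close> because \<open>\<sigma>\<close> is bounded, so dominated convergence turns this into
  convergence in \<open>L\<^sup>p\<close>, and Minkowski's inequality concludes.

  Uniform boundedness comes from a direct open-mapping argument: by Baire's theorem, each \<open>x\<close> in some
  ball is approximated arbitrarily well by points whose projections are bounded by a fixed constant.
  Iterating on the remainder writes \<open>x\<close> as a series of points with geometrically decreasing
  projection bounds, and uniqueness of the basis expansion allows \<open>\<Pi>\<^sub>N\<close> to be applied termwise.\<close>

subsection \<open>Uniform boundedness of the basis projections\<close>

lemma schauder_coeff_sums:
  assumes "normalized_schauder_basis e"
  shows "(\<lambda>k. schauder_coeff e x k *\<^sub>R e k) sums x"
proof -
  have "\<exists>!c. (\<lambda>k. c k *\<^sub>R e k) sums x"
    using assms unfolding normalized_schauder_basis_def by blast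
  then show ?thesis
    unfolding schauder_coeff_def by (rule theI')
qed

lemma schauder_coeff_unique:
  assumes "normalized_schauder_basis e" "(\<lambda>k. d k *\<^sub>R e k) sums x"
  shows "schauder_coeff e x = d"
  using assms schauder_coeff_sums[OF assms(1), of x] unfolding normalized_schauder_basis_def by blast

lemma schauder_proj_tendsto:
  assumes "normalized_schauder_basis e"
  shows "(\<lambda>N. schauder_proj e N x) \<longlonglongrightarrow> x"
  using schauder_coeff_sums[OF assms, of x] unfolding sums_def schauder_proj_def .

lemma schauder_proj_add:
  assumes "normalized_schauder_basis e"
  shows "schauder_proj e N (x + y) = schauder_proj e N x + schauder_proj e N y"
proof -
  have "(\<lambda>k. (schauder_coeff e x k + schauder_coeff e y k) *\<^sub>R e k) sums (x + y)"
    using sums_add[OF schauder_coeff_sums[OF assms, of x] schauder_coeff_sums[OF assms, of y]]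
    by (simp add: scaleR_add_left)
  from schauder_coeff_unique[OF assms this] show ?thesis
    by (simp add: schauder_proj_def scaleR_add_left sum.distrib)
qed

lemma schauder_proj_scaleR:
  assumes "normalized_schauder_basis e"
  shows "schauder_proj e N (r *\<^sub>R x) = r *\<^sub>R schauder_proj e N x"
proof -
  have "(\<lambda>k. (r * schauder_coeff e x k) *\<^sub>R e k) sums (r *\<^sub>R x)"
    using sums_scaleR_right[OF schauder_coeff_sums[OF assms, of x], of r] by simp
  from schauder_coeff_unique[OF assms this] show ?thesis
    by (simp add: schauder_proj_def scaleR_sum_right)
qed

lemma linear_schauder_proj:
  assumes "normalized_schauder_basis e"
  shows "linear (schauder_proj e N)"
  by (intro linearI schauder_proj_add schauder_proj_scaleR assms)

lemma schauder_proj_series: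
  fixes e :: "nat \<Rightarrow> 'a::banach"
  assumes basis: "normalized_schauder_basis e"
    and bound: "\<And>k N. norm (schauder_proj e N (y k)) \<le> b k"
    and summ: "summable b"
    and y: "y sums x"
  shows "schauder_proj e N x = (\<Sum>k. schauder_proj e N (y k))"
proof -
  \<comment> \<open>Two consecutive projections differ by one term, and
    \<open>norm (e j) = 1\<close> turns the bounds on both into a bound on the coefficient.\<close>
  have coeff_bound: "norm (schauder_coeff e (y k) j) \<le> 2 * b k" for k j
  proof -
    have "schauder_proj e (Suc j) (y k) - schauder_proj e j (y k) = schauder_coeff e (y k) j *\<^sub>R e j"
      by (simp add: schauder_proj_def)
    then have "norm (schauder_coeff e (y k) j *\<^sub>R e j) \<le> b k + b k"
      by (metis norm_triangle_ineq4 order_trans add_mono bound)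
    then show ?thesis
      using basis by (simp add: normalized_schauder_basis_def)
  qed
  have summable_coeff: "summable (\<lambda>k. schauder_coeff e (y k) j)" for j
    by (rule summable_comparison_test[OF _ summable_mult[OF summ, of 2]]) (use coeff_bound in auto)
  define d where "d j = (\<Sum>k. schauder_coeff e (y k) j)" for j
  have partial: "(\<Sum>j<N. d j *\<^sub>R e j) = (\<Sum>k. schauder_proj e N (y k))" for N
  proof -
    have "(\<lambda>k. schauder_coeff e (y k) j *\<^sub>R e j) sums (d j *\<^sub>R e j)" for j
      unfolding d_def by (intro sums_scaleR_left summable_sums summable_coeff)
    then have "(\<lambda>k. \<Sum>j<N. schauder_coeff e (y k) j *\<^sub>R e j) sums (\<Sum>j<N. d j *\<^sub>R e j)"
      by (intro sums_sum)
    then show ?thesis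
      unfolding schauder_proj_def by (simp add: sums_iff)
  qed
  \<comment> \<open>\<open>y k\<close> is the limit of its own projections and inherits their
    bound.\<close>
  have norm_y: "norm (y k) \<le> b k" for k
    by (rule tendsto_upperbound[OF tendsto_norm[OF schauder_proj_tendsto[OF basis]]])
      (use bound in auto)
  have diff_bound: "norm (y k - schauder_proj e N (y k)) \<le> 2 * b k" for k N
    using norm_triangle_ineq4[of "y k" "schauder_proj e N (y k)"] norm_y[of k] bound[of N k] by linarith
  have summ2: "summable (\<lambda>k. 2 * b k)"
    by (rule summable_mult[OF summ])
  have summable_diff: "summable (\<lambda>k. norm (y k - schauder_proj e N (y k)))" for N
    by (rule summable_comparison_test[OF _ summ2]) (use diff_bound in auto)
  \<comment> \<open>Each term tends to 0 in \<open>N\<close> under the summable majorant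
    \<open>2 * b k\<close>, so Tannery's theorem exchanges limit and sum.\<close>
  have lim: "(\<lambda>N. \<Sum>k. norm (y k - schauder_proj e N (y k))) \<longlonglongrightarrow> (\<Sum>k. 0)"
  proof (rule tannerys_theorem[where M = "\<lambda>k. 2 * b k", THEN conjunct2, THEN conjunct2])
    show "(\<lambda>N. norm (y k - schauder_proj e N (y k))) \<longlonglongrightarrow> 0" for k
      using tendsto_norm[OF tendsto_diff[OF tendsto_const schauder_proj_tendsto[OF basis]], of "y k" "y k"]
      by simp
  qed (use diff_bound summ2 in \<open>auto simp: case_prod_unfold\<close>)
  have est: "norm ((\<Sum>j<N. d j *\<^sub>R e j) - x) \<le> (\<Sum>k. norm (y k - schauder_proj e N (y k)))" for N
  proof -
    have "summable (\<lambda>k. schauder_proj e N (y k))"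
      by (rule summable_comparison_test[OF _ summ]) (use bound in auto)
    then have "x - (\<Sum>k. schauder_proj e N (y k)) = (\<Sum>k. y k - schauder_proj e N (y k))"
      using y by (metis sums_iff suminf_diff)
    then show ?thesis
      using summable_norm[OF summable_diff[of N]] unfolding partial by (metis norm_minus_commute)
  qed
  have "(\<lambda>N. (\<Sum>j<N. d j *\<^sub>R e j) - x) \<longlonglongrightarrow> 0"
    by (rule Lim_null_comparison[OF always_eventually]) (use est lim in auto)
  then have "(\<lambda>j. d j *\<^sub>R e j) sums x"
    unfolding sums_def by (simp add: LIM_zero_iff)
  then show ?thesis
    using partial[of N] schauder_coeff_unique[OF basis] by (metis schauder_proj_def)
qed

text \<open>The sets below are not known to be closed, so Baire's theorem only bounds the projections on
  points that are dense in a ball.\<close>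

lemma schauder_proj_approx:
  fixes e :: "nat \<Rightarrow> 'a::banach"
  assumes basis: "normalized_schauder_basis e"
  shows "\<exists>m>0. \<exists>s>0. \<forall>v \<eta>. norm v < s \<longrightarrow> \<eta> > 0 \<longrightarrow>
    (\<exists>y. (\<forall>N. norm (schauder_proj e N y) \<le> m) \<and> norm (v - y) < \<eta>)"
proof -
  define S where "S n = {x. \<forall>N. norm (schauder_proj e N x) \<le> real n}" for n
  have "x \<in> (\<Union>n. closure (S n))" for x
  proof -
    have "bounded (range (\<lambda>N. schauder_proj e N x))"
      by (rule convergent_imp_bounded[OF schauder_proj_tendsto[OF basis]])
    then obtain B where B: "\<And>N. norm (schauder_proj e N x) \<le> B"
      by (auto simp: bounded_iff)
    obtain n where "B \<le> real n"
      using real_arch_simple by blast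
    then have "x \<in> S n"
      unfolding S_def using B order_trans by blast
    then show ?thesis
      using closure_subset by blast
  qed
  then have cover: "\<Union> (range (\<lambda>n. closure (S n))) = UNIV"
    by blast
  \<comment> \<open>Otherwise Baire's theorem would give empty interior to the union of these closed
    sets, which is the whole space.\<close>
  have "\<exists>n. interior (closure (S n)) \<noteq> {}"
  proof (rule ccontr)
    assume "\<not> ?thesis"
    then have "euclidean interior_of (\<Union> (range (\<lambda>n. closure (S n)))) = {}"
      by (intro Baire_category_alt disjI1 completely_metrizable_space_euclidean) auto
    then show False
      unfolding cover by simp
  qed
  then obtain n z s where s: "s > 0" "ball z s \<subseteq> closure (S n)"
    by (metis ex_in_conv mem_interior)
  \<comment> \<open>\<open>Suc n\<close> in place of \<open>n\<close> makes the constant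
    positive.\<close>
  have "\<exists>y. (\<forall>N. norm (schauder_proj e N y) \<le> real (Suc n)) \<and> norm (v - y) < \<eta>"
    if v: "norm v < s" and \<eta>: "\<eta> > 0" for v \<eta>
  proof -
    have "z + v \<in> closure (S n)" "z - v \<in> closure (S n)"
      using v s by (auto simp: subset_iff dist_norm)
    then obtain a a' where a: "a \<in> S n" "norm (a - (z + v)) < \<eta>" "a' \<in> S n" "norm (a' - (z - v)) < \<eta>"
      using \<eta> unfolding closure_approachable dist_norm by metis
    \<comment> \<open>Half the difference of approximants to \<open>z + v\<close> and
      \<open>z - v\<close> cancels the centre \<open>z\<close> and approximates \<open>v\<close>;
      the ball moves to the origin and the bound \<open>n\<close> survives.\<close>
    define y where "y = (1/2) *\<^sub>R (a - a')"
    have "norm (schauder_proj e N y) \<le> real (Suc n)" for N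
    proof -
      have "schauder_proj e N y = (1/2) *\<^sub>R (schauder_proj e N a - schauder_proj e N a')"
        unfolding y_def using linear_schauder_proj[OF basis] by (simp add: linear_cmul linear_diff)
      moreover have "norm (schauder_proj e N a - schauder_proj e N a') \<le> real n + real n"
        using a norm_triangle_ineq4[of "schauder_proj e N a" "schauder_proj e N a'"]
        unfolding S_def by (smt (verit) mem_Collect_eq)
      ultimately show ?thesis by simp
    qed
    moreover have "norm (v - y) < \<eta>"
    proof -
      have "v - y = (1/2) *\<^sub>R ((a' - (z - v)) - (a - (z + v)))"
        by (simp add: y_def algebra_simps flip: scaleR_add_left)
      then show ?thesis
        using norm_triangle_ineq4[of "a' - (z - v)" "a - (z + v)"] a by simp
    qed
    ultimately show ?thesis by blast
  qed
  with s(1) show ?thesis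
    by - (rule exI[of _ "real (Suc n)"], rule conjI, simp, rule exI[of _ s], simp)
qed

text \<open>Each correction halves both the allowed remainder and the allowed projection bound, so
  the bounds form a geometric series with sum \<open>2 * m\<close>.\<close>

lemma schauder_proj_bound_ball:
  fixes e :: "nat \<Rightarrow> 'a::banach"
  assumes basis: "normalized_schauder_basis e"
  shows "\<exists>m>0. \<exists>s>0. \<forall>x N. norm x < s \<longrightarrow> norm (schauder_proj e N x) \<le> m"
proof -
  obtain m s where m: "m > 0" and s: "s > 0"
    and approx: "\<And>v \<eta>. norm v < s \<Longrightarrow> \<eta> > 0 \<Longrightarrow>
      \<exists>y. (\<forall>N. norm (schauder_proj e N y) \<le> m) \<and> norm (v - y) < \<eta>"
    using schauder_proj_approx[OF basis] by metis
  \<comment> \<open>Homogeneity carries the approximation to scale \<open>t\<close>; accuracy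
    \<open>s * t / 2\<close> lets the remainder enter the next step at scale
    \<open>t / 2\<close>.\<close>
  have scaled: "\<exists>y. (\<forall>N. norm (schauder_proj e N y) \<le> m * t) \<and> norm (v - y) < s * t / 2"
    if t: "t > 0" and v: "norm v < s * t" for t v
  proof -
    have "norm (v /\<^sub>R t) < s"
      using t v by (simp add: field_simps)
    then obtain y where y: "\<And>N. norm (schauder_proj e N y) \<le> m" "norm (v /\<^sub>R t - y) < s / 2"
      using approx[of "v /\<^sub>R t" "s / 2"] s by auto
    have "norm (schauder_proj e N (t *\<^sub>R y)) \<le> m * t" for N
      using y(1)[of N] t by (simp add: schauder_proj_scaleR[OF basis] mult.commute)
    moreover have "v - t *\<^sub>R y = t *\<^sub>R (v /\<^sub>R t - y)"
      using t by (simp add: algebra_simps)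
    then have "norm (v - t *\<^sub>R y) = t * norm (v /\<^sub>R t - y)"
      using t by simp
    then have "norm (v - t *\<^sub>R y) < s * t / 2"
      using mult_strict_left_mono[OF y(2) t] by (simp add: mult.commute)
    ultimately show ?thesis by blast
  qed
  have "norm (schauder_proj e N x) \<le> 2 * m" if x: "norm x < s" for x N
  proof -
    \<comment> \<open>Successive approximation: \<open>r n\<close> is the remainder of \<open>x\<close> after \<open>n\<close> geometrically small corrections.\<close>
    have "\<exists>r. \<forall>n. norm (r n) < s * (1/2)^n \<and> (n = 0 \<longrightarrow> r n = x) \<and>
        (\<forall>N. norm (schauder_proj e N (r n - r (Suc n))) \<le> m * (1/2)^n)"
    proof (rule dependent_nat_choice
          [where P = "\<lambda>n v. norm v < s * (1/2)^n \<and> (n = 0 \<longrightarrow> v = x)"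
          and Q = "\<lambda>n v w. \<forall>N. norm (schauder_proj e N (v - w)) \<le> m * (1/2)^n", simplified conj_assoc])
      \<comment> \<open>The clause for \<open>n = 0\<close> in the invariant fixes the start of the
        chosen sequence at \<open>x\<close>; it is vacuous at successors.\<close>
      show "\<exists>v. norm v < s * (1/2)^0 \<and> (0 = 0 \<longrightarrow> v = x)"
        using x by auto
    next
      fix v and n :: nat
      assume "norm v < s * (1/2)^n \<and> (n = 0 \<longrightarrow> v = x)"
      then obtain y where y: "\<forall>N. norm (schauder_proj e N y) \<le> m * (1/2)^n"
          "norm (v - y) < s * (1/2)^n / 2"
        using scaled[of "(1/2)^n" v] by auto
      then show "\<exists>w. norm w < s * (1/2)^Suc n \<and> (Suc n = 0 \<longrightarrow> w = x) \<and>
          (\<forall>N. norm (schauder_proj e N (v - w)) \<le> m * (1/2)^n)"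
        by (intro exI[of _ "v - y"]) simp
    qed
    then obtain r where r: "\<And>n. norm (r n) < s * (1/2)^n" "r 0 = x"
        "\<And>n N. norm (schauder_proj e N (r n - r (Suc n))) \<le> m * (1/2)^n"
      by blast
    have "(\<lambda>n. s * (1/2)^n) \<longlonglongrightarrow> 0"
      by (intro tendsto_mult_right_zero LIMSEQ_power_zero) simp
    then have "r \<longlonglongrightarrow> 0"
      by (rule Lim_null_comparison[OF always_eventually, rotated]) (use r(1) less_imp_le in auto)
    then have sums: "(\<lambda>n. r n - r (Suc n)) sums x"
      using telescope_sums'[of r 0] r(2) by simp
    have geo: "(\<lambda>n. m * (1/2)^n) sums (2 * m)"
      using sums_mult[OF geometric_sums[of "1/2 :: real"], of m] by (simp add: mult.commute)
    have "schauder_proj e N x = (\<Sum>n. schauder_proj e N (r n - r (Suc n)))"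
      by (rule schauder_proj_series[OF basis r(3) _ sums]) (use geo in \<open>simp add: sums_iff\<close>)
    also have "norm \<dots> \<le> (\<Sum>n. m * (1/2)^n)"
      by (rule norm_suminf_le[OF r(3)]) (use geo in \<open>simp add: sums_iff\<close>)
    finally show ?thesis
      using geo by (simp add: sums_iff)
  qed
  with m s show ?thesis
    by - (rule exI[of _ "2 * m"], rule conjI, simp, rule exI[of _ s], simp)
qed

lemma schauder_proj_uniformly_bounded:
  fixes e :: "nat \<Rightarrow> 'a::banach"
  assumes basis: "normalized_schauder_basis e"
  shows "\<exists>K>0. \<forall>N x. norm (schauder_proj e N x) \<le> K * norm x"
proof -
  obtain m s where ms: "m > 0" "s > 0"
    and bound: "\<And>x N. norm x < s \<Longrightarrow> norm (schauder_proj e N x) \<le> m"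
    using schauder_proj_bound_ball[OF basis] by metis
  have "norm (schauder_proj e N x) \<le> 2 * m / s * norm x" for N x
  proof (cases "x = 0")
    case True
    then show ?thesis
      using linear_0[OF linear_schauder_proj[OF basis]] by simp
  next
    case False
    \<comment> \<open>The factor 2 places \<open>t *\<^sub>R x\<close> at norm \<open>s / 2\<close>,
      strictly inside the ball.\<close>
    define t where "t = s / (2 * norm x)"
    have "t > 0" and "norm (t *\<^sub>R x) < s"
      using False ms by (auto simp: t_def)
    then have "t * norm (schauder_proj e N x) \<le> m"
      using bound[of "t *\<^sub>R x" N] by (simp add: schauder_proj_scaleR[OF basis])
    then show ?thesis
      using False ms by (simp add: t_def field_simps)
  qed
  with ms show ?thesis
    by (intro exI[of _ "2 * m / s"]) simp
qed

subsection \<open>Minkowski's inequality and dominated convergence\<close>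

text \<open>If an argument vanishes, \<open>u powr p \<le> u\<close> for \<open>u\<close> in the
  unit interval suffices; otherwise this is convexity of the power on the positive reals.\<close>

lemma powr_convex_combination:
  fixes x y t p :: real
  assumes "1 \<le> p" "0 \<le> x" "0 \<le> y" "0 \<le> t" "t \<le> 1"
  shows "((1 - t) * x + t * y) powr p \<le> (1 - t) * x powr p + t * y powr p"
proof -
  have scale: "(u * z) powr p \<le> u * z powr p" if "0 \<le> u" "u \<le> 1" "0 \<le> z" for u z :: real
  proof -
    have "u powr p \<le> u"
      using that assms(1) powr_mono'[of 1 p u] by (cases "u = 0") auto
    then show ?thesis
      using that by (simp add: powr_mult mult_right_mono)
  qed
  consider "x = 0" | "y = 0" | "x > 0" "y > 0" using assms by linarith
  then show ?thesis
  proof cases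
    case 1
    then show ?thesis using scale[of t y] assms by simp
  next
    case 2
    then show ?thesis using scale[of "1 - t" x] assms by simp
  next
    case 3
    then show ?thesis
      using convex_onD[OF powr_convex[OF assms(1)], of t x y] assms by simp
  qed
qed

lemma Lp_norm_nonneg: "0 \<le> Lp_norm p M f"
  by (simp add: Lp_norm_def)

lemma integral_powr_eq_Lp_norm_powr:
  assumes "0 < p"
  shows "(\<integral>x. \<bar>f x\<bar> powr p \<partial>M) = Lp_norm p M f powr p"
  using assms by (simp add: Lp_norm_def powr_powr integral_nonneg_AE)

text \<open>Convexity with the weights \<open>a / (a + b)\<close> and \<open>b / (a + b)\<close>; taking the two \<open>L\<^sup>p\<close> norms
  for \<open>a\<close> and \<open>b\<close> and integrating gives Minkowski's inequality.\<close>

lemma abs_add_powr_le: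
  fixes u v a b p :: real
  assumes "1 \<le> p" "0 < a" "0 < b"
  shows "\<bar>u + v\<bar> powr p \<le> (a + b) powr p *
    (a / (a + b) * (\<bar>u\<bar> powr p / a powr p) + b / (a + b) * (\<bar>v\<bar> powr p / b powr p))"
proof -
  define t where "t = b / (a + b)"
  have t: "0 \<le> t" "t \<le> 1" "1 - t = a / (a + b)"
    using assms by (auto simp: t_def field_simps)
  have "\<bar>u + v\<bar> \<le> (a + b) * ((1 - t) * (\<bar>u\<bar> / a) + t * (\<bar>v\<bar> / b))"
  proof -
    have "(a + b) * ((1 - t) * (\<bar>u\<bar> / a) + t * (\<bar>v\<bar> / b)) = \<bar>u\<bar> + \<bar>v\<bar>"
      using assms unfolding t(3) unfolding t_def by (simp add: divide_simps)
    then show ?thesis by simp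
  qed
  then have "\<bar>u + v\<bar> powr p \<le> ((a + b) * ((1 - t) * (\<bar>u\<bar> / a) + t * (\<bar>v\<bar> / b))) powr p"
    using assms by (intro powr_mono2) auto
  also have "\<dots> = (a + b) powr p * ((1 - t) * (\<bar>u\<bar> / a) + t * (\<bar>v\<bar> / b)) powr p"
    using assms t by (simp add: powr_mult)
  also have "\<dots> \<le> (a + b) powr p * ((1 - t) * (\<bar>u\<bar> / a) powr p + t * (\<bar>v\<bar> / b) powr p)"
    using assms t by (intro mult_left_mono powr_convex_combination) auto
  finally show ?thesis
    using assms unfolding t(3) unfolding t_def by (simp add: powr_divide)
qed

lemma Lp_space_add:
  assumes "1 \<le> p" "f \<in> Lp_space p M" "g \<in> Lp_space p M"
  shows "(\<lambda>x. f x + g x) \<in> Lp_space p M"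
proof -
  have [measurable]: "f \<in> borel_measurable M" "g \<in> borel_measurable M"
    and int: "integrable M (\<lambda>x. \<bar>f x\<bar> powr p)" "integrable M (\<lambda>x. \<bar>g x\<bar> powr p)"
    using assms unfolding Lp_space_def by auto
  \<comment> \<open>The choice \<open>a = b = 1\<close> in \<open>abs_add_powr_le\<close> supplies
    an integrable majorant.\<close>
  have "integrable M (\<lambda>x. \<bar>f x + g x\<bar> powr p)"
    by (rule Bochner_Integration.integrable_bound
        [where f = "\<lambda>x. (1 + 1) powr p * (1 / (1 + 1) * (\<bar>f x\<bar> powr p / 1 powr p) + 1 / (1 + 1) * (\<bar>g x\<bar> powr p / 1 powr p))"])
      (use int abs_add_powr_le[OF assms(1), of 1 1] in \<open>auto intro!: AE_I2\<close>)
  then show ?thesis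
    unfolding Lp_space_def by simp
qed

lemma Lp_norm_triangle:
  assumes "1 \<le> p" "f \<in> Lp_space p M" "g \<in> Lp_space p M"
  shows "Lp_norm p M (\<lambda>x. f x + g x) \<le> Lp_norm p M f + Lp_norm p M g"
proof (rule field_le_epsilon)
  fix \<eta> :: real assume \<eta>: "0 < \<eta>"
  \<comment> \<open>The norms may vanish, whereas \<open>abs_add_powr_le\<close> divides by positive
    \<open>a\<close> and \<open>b\<close>; hence the slack \<open>\<eta> / 2\<close> in
    each.\<close>
  define a where "a = Lp_norm p M f + \<eta> / 2"
  define b where "b = Lp_norm p M g + \<eta> / 2"
  have ab: "a > 0" "b > 0" "Lp_norm p M f \<le> a" "Lp_norm p M g \<le> b"
    using \<eta> Lp_norm_nonneg[of p M] by (auto simp: a_def b_def add_nonneg_pos)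
  have int: "integrable M (\<lambda>x. \<bar>f x\<bar> powr p)" "integrable M (\<lambda>x. \<bar>g x\<bar> powr p)"
    using assms unfolding Lp_space_def by auto
  have int_add: "integrable M (\<lambda>x. \<bar>f x + g x\<bar> powr p)"
    using Lp_space_add[OF assms] unfolding Lp_space_def by simp
  have p: "p > 0" using assms(1) by simp
  have le1: "(\<integral>x. \<bar>f x\<bar> powr p \<partial>M) / a powr p \<le> 1" "(\<integral>x. \<bar>g x\<bar> powr p \<partial>M) / b powr p \<le> 1"
    using ab p Lp_norm_nonneg[of p M] by (simp_all add: integral_powr_eq_Lp_norm_powr powr_mono2)
  have "Lp_norm p M (\<lambda>x. f x + g x) powr p = (\<integral>x. \<bar>f x + g x\<bar> powr p \<partial>M)"
    using integral_powr_eq_Lp_norm_powr[OF p] by metis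
  also have "\<dots> \<le> (\<integral>x. (a + b) powr p * (a / (a + b) * (\<bar>f x\<bar> powr p / a powr p) +
      b / (a + b) * (\<bar>g x\<bar> powr p / b powr p)) \<partial>M)"
    using int int_add abs_add_powr_le[OF assms(1) ab(1,2)] by (intro integral_mono) auto
  also have "\<dots> = (a + b) powr p * (a / (a + b) * ((\<integral>x. \<bar>f x\<bar> powr p \<partial>M) / a powr p) +
      b / (a + b) * ((\<integral>x. \<bar>g x\<bar> powr p \<partial>M) / b powr p))"
    using int by simp
  also have "\<dots> \<le> (a + b) powr p * (a / (a + b) * 1 + b / (a + b) * 1)"
    using ab le1 by (intro mult_left_mono add_mono) auto
  also have "\<dots> = (a + b) powr p"
    using ab by (simp add: divide_simps)
  finally have "Lp_norm p M (\<lambda>x. f x + g x) \<le> a + b"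
    using powr_less_mono2[OF p, of "a + b" "Lp_norm p M (\<lambda>x. f x + g x)"] ab by linarith
  then show "Lp_norm p M (\<lambda>x. f x + g x) \<le> Lp_norm p M f + Lp_norm p M g + \<eta>"
    by (simp add: a_def b_def)
qed

lemma (in finite_measure) bounded_in_Lp_space:
  fixes f :: "'a \<Rightarrow> real"
  assumes "0 \<le> p" "f \<in> borel_measurable M" "\<And>x. \<bar>f x\<bar> \<le> C"
  shows "f \<in> Lp_space p M"
proof -
  have "integrable M (\<lambda>x. \<bar>f x\<bar> powr p)"
    using assms by (intro integrable_const_bound[where B = "C powr p"]) (auto intro!: AE_I2 powr_mono2)
  with assms show ?thesis
    unfolding Lp_space_def by simp
qed

text \<open>On a finite measure space the constant \<open>C powr p\<close> is an integrable
  majorant, so dominated convergence applies.\<close>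

lemma (in finite_measure) Lp_norm_tendsto_zero:
  fixes h :: "nat \<Rightarrow> 'a \<Rightarrow> real"
  assumes p: "0 < p" and meas: "\<And>n. h n \<in> borel_measurable M"
    and bound: "\<And>n x. \<bar>h n x\<bar> \<le> C" and lim: "\<And>x. (\<lambda>n. h n x) \<longlonglongrightarrow> 0"
  shows "(\<lambda>n. Lp_norm p M (h n)) \<longlonglongrightarrow> 0"
proof -
  \<comment> \<open>Used twice: with exponent \<open>p\<close> under the integral and with
    \<open>1 / p\<close> for the outer root.\<close>
  have powr_null: "(\<lambda>n. \<bar>u n\<bar> powr q) \<longlonglongrightarrow> 0" if "u \<longlonglongrightarrow> 0" "0 < q" for u :: "nat \<Rightarrow> real" and q :: real
    by (rule tendsto_zero_powrI[OF tendsto_rabs_zero[OF that(1)] tendsto_const _ that(2)]) simp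
  have "(\<lambda>n. \<integral>x. \<bar>h n x\<bar> powr p \<partial>M) \<longlonglongrightarrow> (\<integral>x. 0 \<partial>M)"
  proof (rule integral_dominated_convergence[where w = "\<lambda>_. C powr p"])
    show "AE x in M. (\<lambda>n. \<bar>h n x\<bar> powr p) \<longlonglongrightarrow> 0"
      using powr_null[OF lim p] by simp
    show "AE x in M. norm (\<bar>h n x\<bar> powr p) \<le> C powr p" for n
      using bound p by (auto intro!: AE_I2 powr_mono2)
  qed (use meas in auto)
  from powr_null[OF this[simplified], of "1 / p"] show ?thesis
    using p unfolding Lp_norm_def by (simp add: abs_of_nonneg integral_nonneg_AE)
qed

subsection \<open>Convergence of projected networks\<close>

text \<open>Split \<open>y N\<close> as \<open>(y N - x) + x\<close>: the uniform bound
  \<open>K\<close> controls the projection of the first part, and convergence of the expansion of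
  \<open>x\<close> handles the second.\<close>

lemma schauder_proj_tendsto_diagonal:
  fixes e :: "nat \<Rightarrow> 'a::banach"
  assumes basis: "normalized_schauder_basis e" and y: "y \<longlonglongrightarrow> x"
  shows "(\<lambda>N. schauder_proj e N (y N)) \<longlonglongrightarrow> x"
proof -
  obtain K where K: "K > 0" "\<And>N x. norm (schauder_proj e N x) \<le> K * norm x"
    using schauder_proj_uniformly_bounded[OF basis] by metis
  have "(\<lambda>N. K * norm (y N - x)) \<longlonglongrightarrow> 0"
    using y by (intro tendsto_mult_right_zero tendsto_norm_zero LIM_zero)
  then have "(\<lambda>N. schauder_proj e N (y N - x)) \<longlonglongrightarrow> 0"
    by (rule Lim_null_comparison[OF always_eventually, rotated]) (use K(2) in auto)
  from tendsto_add[OF this schauder_proj_tendsto[OF basis, of x]] show ?thesis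
    by (simp add: linear_diff[OF linear_schauder_proj[OF basis]])
qed

text \<open>This makes the projected networks continuous, hence Borel measurable.\<close>

lemma bounded_linear_schauder_proj:
  fixes e :: "nat \<Rightarrow> 'a::banach"
  assumes basis: "normalized_schauder_basis e"
  shows "bounded_linear (schauder_proj e N)"
proof -
  obtain K where "\<And>N x. norm (schauder_proj e N x) \<le> K * norm x"
    using schauder_proj_uniformly_bounded[OF basis] by metis
  then show ?thesis
    by (intro bounded_linear_intro[where K = K] schauder_proj_add schauder_proj_scaleR basis)
      (simp add: mult.commute)
qed

text \<open>The conclusion includes membership in \<open>Lp_space\<close> because
  \<open>Lp_norm\<close> is 0 when the integral does not exist, so the norm bound alone would not
  show that the error is small.\<close>

theorem proposition3p1:
  fixes e :: "nat \<Rightarrow> 'a::banach"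
    and \<sigma> :: "'a \<Rightarrow> 'a"
    and \<mu> :: "'a measure"
    and p \<delta> :: real
    and M :: nat
    and l :: "nat \<Rightarrow> 'a \<Rightarrow>\<^sub>L real"
    and A :: "nat \<Rightarrow> 'a \<Rightarrow>\<^sub>L 'a"
    and b :: "nat \<Rightarrow> 'a"
    and Neps :: "'a \<Rightarrow> real"
  assumes separable: "separable_space (euclidean :: 'a topology)"
    and basis: "normalized_schauder_basis e"
    and cont: "continuous_on UNIV \<sigma>"
    and bdd: "bounded (range \<sigma>)"
    and prob: "prob_space \<mu>"
    and borel: "sets \<mu> = sets borel"
    and p: "1 \<le> p"
    and Neps_in: "Neps \<in> neural_span \<sigma>"
    and Neps_eq: "Neps = (\<lambda>x. \<Sum>j=1..M. blinfun_apply (l j) (\<sigma> (blinfun_apply (A j) x + b j)))"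
    and delta: "0 < \<delta>"
  shows "\<exists>Nstar::nat. \<forall>f\<in>Lp_space p \<mu>. \<forall>\<epsilon>>0.
           Lp_norm p \<mu> (\<lambda>x. f x - Neps x) < \<epsilon> \<longrightarrow>
           (\<forall>N\<ge>Nstar.
              (let P = schauder_proj e N;
                   g = (\<lambda>x. f x - (\<Sum>j=1..M.
                          (blinfun_apply (l j) \<circ> P)
                            (\<sigma> (P (blinfun_apply (A j) (P x)) + P (b j)))))
               in g \<in> Lp_space p \<mu> \<and> Lp_norm p \<mu> g < \<epsilon> + \<delta>))"
proof -
  interpret prob_space \<mu> by (rule prob)
  define G where "G N x = (\<Sum>j=1..M. (blinfun_apply (l j) \<circ> schauder_proj e N)
      (\<sigma> (schauder_proj e N (blinfun_apply (A j) (schauder_proj e N x)) + schauder_proj e N (b j))))"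
    for N x
  obtain K where K: "K > 0" "\<And>N x. norm (schauder_proj e N x) \<le> K * norm x"
    using schauder_proj_uniformly_bounded[OF basis] by metis
  obtain S where S: "\<And>x. norm (\<sigma> x) \<le> S"
    using bdd by (auto simp: bounded_iff)
  have cont_proj: "continuous_on X (\<lambda>x. schauder_proj e N (h x))"
    if "continuous_on X h" for X N and h :: "'a \<Rightarrow> 'a"
    using bounded_linear.continuous_on[OF bounded_linear_schauder_proj[OF basis] that] .
  have cont_\<sigma>: "continuous_on X (\<lambda>x. \<sigma> (h x))" if "continuous_on X h" for X and h :: "'a \<Rightarrow> 'a"
    using continuous_on_compose2[OF cont that] by simp
  have measurable_\<mu>: "h \<in> borel_measurable \<mu>" if "continuous_on UNIV h" for h :: "'a \<Rightarrow> real"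
    using borel_measurable_continuous_onI[OF that] measurable_cong_sets[OF borel refl] by blast
  have meas_G: "G N \<in> borel_measurable \<mu>" for N
    unfolding G_def comp_def
    by (intro measurable_\<mu> continuous_intros cont_proj cont_\<sigma>)
  have meas_Neps: "Neps \<in> borel_measurable \<mu>"
    unfolding Neps_eq by (intro measurable_\<mu> continuous_intros cont_\<sigma>)
  define C where "C = (\<Sum>j=1..M. norm (l j) * S)"
  have bound_Neps: "\<bar>Neps x\<bar> \<le> C" for x
    unfolding Neps_eq C_def
  proof (rule order_trans[OF sum_abs sum_mono])
    fix j
    let ?y = "\<sigma> (blinfun_apply (A j) x + b j)"
    show "\<bar>blinfun_apply (l j) ?y\<bar> \<le> norm (l j) * S"
      using norm_blinfun[of "l j" ?y] mult_left_mono[OF S norm_ge_zero, of "l j"]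
      by (metis order_trans real_norm_def)
  qed
  \<comment> \<open>The factor \<open>K\<close> accounts for the projection outside
    \<open>\<sigma>\<close>; the bound does not depend on \<open>N\<close>.\<close>
  define C' where "C' = (\<Sum>j=1..M. norm (l j) * (K * S))"
  have bound_G: "\<bar>G N x\<bar> \<le> C'" for N x
    unfolding G_def C'_def
  proof (rule order_trans[OF sum_abs sum_mono])
    fix j
    let ?y = "\<sigma> (schauder_proj e N (blinfun_apply (A j) (schauder_proj e N x)) + schauder_proj e N (b j))"
    have "norm (schauder_proj e N ?y) \<le> K * S"
      using K(2)[of N ?y] mult_left_mono[OF S[of "schauder_proj e N (blinfun_apply (A j) (schauder_proj e N x)) + schauder_proj e N (b j)"], of K] K(1)
      by linarith
    then show "\<bar>(blinfun_apply (l j) \<circ> schauder_proj e N) ?y\<bar> \<le> norm (l j) * (K * S)"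
      using norm_blinfun[of "l j" "schauder_proj e N ?y"]
      by (simp add: order_trans mult_left_mono)
  qed
  \<comment> \<open>The diagonal lemma serves outside \<open>\<sigma>\<close> and again inside,
    since both times the projection acts on a point that itself varies with \<open>N\<close>;
    continuity of \<open>\<sigma>\<close> links the two.\<close>
  have lim_G: "(\<lambda>N. G N x) \<longlonglongrightarrow> Neps x" for x
    unfolding G_def Neps_eq comp_def
  proof (intro tendsto_sum blinfun.tendsto[OF tendsto_const] schauder_proj_tendsto_diagonal[OF basis])
    fix j
    have "(\<lambda>N. schauder_proj e N (blinfun_apply (A j) (schauder_proj e N x)) + schauder_proj e N (b j))
        \<longlonglongrightarrow> blinfun_apply (A j) x + b j"
      by (intro tendsto_add schauder_proj_tendsto_diagonal schauder_proj_tendsto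
          blinfun.tendsto[OF tendsto_const] basis)
    then show "(\<lambda>N. \<sigma> (schauder_proj e N (blinfun_apply (A j) (schauder_proj e N x)) + schauder_proj e N (b j)))
        \<longlonglongrightarrow> \<sigma> (blinfun_apply (A j) x + b j)"
      using continuous_on_tendsto_compose[OF cont] by simp
  qed
  have p0: "0 < p" using p by simp
  have bound_diff: "\<bar>Neps x - G N x\<bar> \<le> C + C'" for N x
    using bound_Neps[of x] bound_G[of N x] by linarith
  have "(\<lambda>N. Lp_norm p \<mu> (\<lambda>x. Neps x - G N x)) \<longlonglongrightarrow> 0"
  proof (rule Lp_norm_tendsto_zero[OF p0 _ bound_diff])
    show "(\<lambda>x. Neps x - G N x) \<in> borel_measurable \<mu>" for N
      using meas_Neps meas_G by simp
    show "(\<lambda>N. Neps x - G N x) \<longlonglongrightarrow> 0" for x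
      using tendsto_diff[OF tendsto_const lim_G, of "Neps x" x] by simp
  qed
  \<comment> \<open>Neither \<open>f\<close> nor \<open>\<epsilon>\<close> enters the choice of the
    threshold.\<close>
  from order_tendstoD(2)[OF this delta]
  obtain Nstar where Nstar: "\<And>N. N \<ge> Nstar \<Longrightarrow> Lp_norm p \<mu> (\<lambda>x. Neps x - G N x) < \<delta>"
    unfolding eventually_sequentially by blast
  have diff_Lp: "(\<lambda>x. Neps x - G N x) \<in> Lp_space p \<mu>" for N
    using bounded_in_Lp_space[OF _ _ bound_diff] p0 meas_Neps meas_G by simp
  have "(\<lambda>x. f x - G N x) \<in> Lp_space p \<mu> \<and> Lp_norm p \<mu> (\<lambda>x. f x - G N x) < \<epsilon> + \<delta>"
    if f: "f \<in> Lp_space p \<mu>" "Lp_norm p \<mu> (\<lambda>x. f x - Neps x) < \<epsilon>" and N: "N \<ge> Nstar" for f \<epsilon> N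
  proof -
    \<comment> \<open>Minkowski's inequality is applied to
      \<open>f - G N = (f - Neps) + (Neps - G N)\<close>; the first summand lies in
      \<open>Lp_space\<close> because \<open>Neps\<close> is bounded.\<close>
    have "(\<lambda>x. - Neps x) \<in> Lp_space p \<mu>"
      using bounded_in_Lp_space[of p "\<lambda>x. - Neps x" C] p0 meas_Neps bound_Neps by simp
    from Lp_space_add[OF p f(1) this] have "(\<lambda>x. f x - Neps x) \<in> Lp_space p \<mu>"
      by simp
    from Lp_space_add[OF p this diff_Lp[of N]] Lp_norm_triangle[OF p this diff_Lp[of N]]
    show ?thesis
      using Nstar[OF N] f(2) by simp
  qed
  then show ?thesis
    unfolding Let_def G_def[symmetric] by blast
qed

end
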